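(* Let $(R_j)_{j\ge 0}$ be any sequence in $\{0,1\}$ with $R_0=0$ (a prescribed right half). Then there is exactly one sequence $(L_j)_{j\ge 1}$ in $\{0,1\}$ (left half) such that the configuration $x\in\{0,1\}^{\mathbb Z}$ defined by $x_j=R_j$ for $j\ge 0$ and $x_{-j}=L_j$ for $j\ge 1$ has identically zero central trace, i.e. $F^t(x)_0=0$ for all $t\ge 0$. This unique left half is as follows. (i) If $R_j=1$ for some $j\ge1$, let $m=\min\{j\ge 1: R_j=1\}$. Then (with $R_j$ for $j>m$ arbitrary) $$L_j=0\ \ (1\le j<m),\qquad L_m=1,\qquad L_j=j\bmod 2\ \ (j>m).$$ (ii) If $R_j=0$ for all $j\ge 1$, then the unique configuration $x$ is the zero configuration. Equivalently, in both cases the unique left half is given by $$L_{2k+1}=\bigvee_{j=1}^{2k+1}R_j\quad (k\ge 0),\qquad L_{2k}=R_{2k}\land\neg\bigvee_{j=1}^{2k-1}R_j\quad(k\ge 1).$$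
   Context: Rule 30 is the map $F:\{0,1\}^{\mathbb Z}\to\{0,1\}^{\mathbb Z}$ given by $F(x)_i=x_{i-1}\oplus(x_i\lor x_{i+1})$, where $\oplus$ is addition modulo $2$ and $\lor$ is Boolean disjunction ($\land$ and $\neg$ are Boolean conjunction and negation). $F^t$ is the $t$-fold iterate, with $F^0(x)=x$. The central trace of a configuration $x$ is the sequence $(F^t(x)_0)_{t\ge 0}$. *)

theory Defs
  imports Main "HOL-Library.FuncSet"
begin

text \<open>The alphabet \<open>{0,1}\<close> is \<^typ>\<open>bool\<close>, with \<^const>\<open>True\<close> for 1;
  addition modulo 2 is then \<open>\<noteq>\<close>.\<close>

definition rule30 :: "(int \<Rightarrow> bool) \<Rightarrow> int \<Rightarrow> bool" where
  "rule30 x = (\<lambda>i. x (i - 1) \<noteq> (x i \<or> x (i + 1)))"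

definition central_trace :: "(int \<Rightarrow> bool) \<Rightarrow> nat \<Rightarrow> bool" where
  "central_trace x = (\<lambda>t. (rule30 ^^ t) x 0)"

text \<open>Left halves are indexed from 1; the value \<open>L 0\<close> is never used.\<close>

definition config :: "(nat \<Rightarrow> bool) \<Rightarrow> (nat \<Rightarrow> bool) \<Rightarrow> int \<Rightarrow> bool" where
  "config L R = (\<lambda>i. if i \<ge> 0 then R (nat i) else L (nat (- i)))"

definition zero_trace :: "(int \<Rightarrow> bool) \<Rightarrow> bool" where
  "zero_trace x \<longleftrightarrow> (\<forall>t. central_trace x t = False)"

end

theory Submission
  imports Defs
begin

text \<open>
  Uniqueness is left permutivity of Rule 30: the new value at \<open>i\<close> is the old value at \<open>i - 1\<close>, possibly
  flipped depending on the cells at \<open>i\<close> and \<open>i + 1\<close>. A change at a cell, with everything to its right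
  kept, therefore travels right at speed one and reaches the origin unabsorbed, so the central trace
  determines the left half (\<open>left_half_unique\<close>).

  For existence, suppose that the origin stays \<open>0\<close>. Then column \<open>1\<close> obeys
  \<open>x\<^sub>1' = x\<^sub>1 \<or> x\<^sub>2\<close>, so it never returns to \<open>0\<close> once it is \<open>1\<close>, and it becomes \<open>1\<close> exactly when the
  first \<open>1\<close> of the right half, which moves left by one cell per step, arrives there. If this first
  \<open>1\<close> starts at \<open>m\<close>, column \<open>1\<close> is \<open>1\<close> exactly for \<open>t \<ge> m - 1\<close>, independently of all
  later cells. The origin stays \<open>0\<close> only if column \<open>-1\<close> equals column \<open>1\<close>, and solving the rule for
  the left neighbour then yields the columns further left one after the other: column \<open>-j\<close> is
  \<open>1\<close> exactly for \<open>t \<ge> m - j\<close> if \<open>j\<close> is odd, and only for \<open>t = m - j\<close> if \<open>j\<close> is even. The resulting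
  space-time pattern depends on \<open>t\<close> only through \<open>m - t\<close>; \<open>wavefront\<close> describes its rows, and
  \<open>wavefront_rule30\<close> shows that Rule 30 moves from each row to the next. The left part of the row at
  \<open>t = 0\<close> is the claimed left half. A right half without a \<open>1\<close> belongs to the zero configuration,
  which is a fixed point.
\<close>

section \<open>Left permutivity and uniqueness\<close>

text \<open>At each step the rightmost cell in which the two configurations may differ moves right by one.
  The cell reached then takes its left neighbour's value, flipped in both configurations or in neither,
  since its own old value and that of its right neighbour are common to both. Thus whether they
  differ there never changes.\<close>

lemma rule30_pow_left_permutive:
  assumes "\<forall>i>a. x i = y i"
  shows "(\<forall>i>a + int t. (rule30 ^^ t) x i = (rule30 ^^ t) y i) \<and>
    ((rule30 ^^ t) x (a + int t) = (rule30 ^^ t) y (a + int t) \<longleftrightarrow> x a = y a)"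
proof (induction t)
  case 0
  then show ?case using assms by simp
next
  case (Suc t)
  let ?u = "(rule30 ^^ t) x" and ?v = "(rule30 ^^ t) y"
  have eq: "?u i = ?v i" if "i > a + int t" for i
    using Suc that by blast
  have front: "?u (a + int t) = ?v (a + int t) \<longleftrightarrow> x a = y a"
    using Suc by blast
  have "rule30 ?u i = rule30 ?v i" if "i > a + int (Suc t)" for i
    using that by (simp add: rule30_def eq)
  moreover have "rule30 ?u (a + int (Suc t)) = rule30 ?v (a + int (Suc t)) \<longleftrightarrow> x a = y a"
  proof -
    have "a + int (Suc t) - 1 = a + int t" by simp
    then show ?thesis
      using front by (auto simp: rule30_def eq)
  qed
  ultimately show ?case by simp
qed

text \<open>By strong induction from the origin outwards: if the halves agree before position \<open>j\<close>, a
  disagreement at \<open>j\<close> would be visible in the central trace at time \<open>j\<close>.\<close>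

lemma left_half_unique:
  assumes "zero_trace (config L R)" and "zero_trace (config L' R)" and "j \<ge> 1"
  shows "L j = L' j"
  using \<open>j \<ge> 1\<close>
proof (induction j rule: less_induct)
  case (less j)
  have "config L R i = config L' R i" if "i > - int j" for i
    using less.IH[of "nat (- i)"] that by (auto simp: config_def)
  then have "(rule30 ^^ j) (config L R) (- int j + int j) =
      (rule30 ^^ j) (config L' R) (- int j + int j) \<longleftrightarrow>
      config L R (- int j) = config L' R (- int j)"
    using rule30_pow_left_permutive by blast
  then show ?case
    using assms(1,2) less.prems by (simp add: zero_trace_def central_trace_def config_def)
qed

lemma config_cong:
  assumes "\<And>j. j \<ge> 1 \<Longrightarrow> L j = L' j"
  shows "config L R = config L' R"
  using assms by (auto simp: config_def fun_eq_iff)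

section \<open>The travelling pattern\<close>

text \<open>The row in which the first \<open>1\<close> of the original right half has reached position \<open>n\<close>. For
  \<open>n \<le> 0\<close> it has been absorbed at the origin and has left a permanent \<open>1\<close> at position \<open>1\<close>. Cells
  right of \<open>max 1 n\<close> are unconstrained: they cannot overtake the first \<open>1\<close>, and after its arrival
  the disjunction \<open>x\<^sub>1 \<or> x\<^sub>2\<close> hides them.\<close>

definition wavefront :: "int \<Rightarrow> (int \<Rightarrow> bool) \<Rightarrow> bool" where
  "wavefront n x \<longleftrightarrow> \<not> x 0 \<and> (\<forall>i. 0 < i \<and> i < n \<longrightarrow> \<not> x i) \<and> x (max 1 n) \<and>
    (\<forall>j\<ge>1. x (- j) = (if odd j then n \<le> j else j = n))"

lemma wavefront_rule30:
  assumes "wavefront n x"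
  shows "wavefront (n - 1) (rule30 x)"
proof -
  have origin: "\<not> x 0" and gap: "\<And>i. 0 < i \<Longrightarrow> i < n \<Longrightarrow> \<not> x i" and front: "x (max 1 n)"
    and left: "\<And>j. j \<ge> 1 \<Longrightarrow> x (- j) = (if odd j then n \<le> j else j = n)"
    using assms by (auto simp: wavefront_def)
  \<comment> \<open>Columns \<open>1\<close> and \<open>-1\<close> agree, which keeps the origin at \<open>0\<close>.\<close>
  have one: "x 1 \<longleftrightarrow> n \<le> 1"
    using gap[of 1] front by (cases "n \<le> 1") (auto simp: max_def split: if_splits)
  have "\<not> rule30 x 0"
    using left[of 1] origin one by (simp add: rule30_def)
  moreover have "\<not> rule30 x i" if "0 < i" "i < n - 1" for i
    using gap[of "i - 1"] gap[of i] gap[of "i + 1"] origin that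
    by (cases "i = 1") (auto simp: rule30_def)
  moreover have "rule30 x (max 1 (n - 1))"
  proof (cases "n \<le> 2")
    case True
    then have "x 1 \<or> x 2"
      using front by (cases "n = 2") (auto simp: one)
    moreover have "max 1 (n - 1) = 1"
      using True by simp
    ultimately show ?thesis
      using origin by (simp add: rule30_def)
  next
    case False
    then show ?thesis
      using front gap[of "n - 2"] by (simp add: rule30_def max_def)
  qed
  moreover have "rule30 x (- j) = (if odd j then n - 1 \<le> j else j = n - 1)" if "j \<ge> 1" for j
  proof -
    have "rule30 x (- j) = (x (- (j + 1)) \<noteq> (x (- j) \<or> x (- (j - 1))))"
      by (simp add: rule30_def)
    moreover have "x (- (j - 1)) = (j \<noteq> 1 \<and> (if odd (j - 1) then n \<le> j - 1 else j - 1 = n))"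
      using left[of "j - 1"] origin that by (cases "j = 1") auto
    ultimately show ?thesis
      using left[of j] left[of "j + 1"] that by (cases "odd j") auto
  qed
  ultimately show ?thesis
    by (simp add: wavefront_def)
qed

lemma wavefront_zero_trace:
  assumes "wavefront n x"
  shows "zero_trace x"
proof -
  have "wavefront (n - int t) ((rule30 ^^ t) x)" for t
  proof (induction t)
    case (Suc t)
    from wavefront_rule30[OF this] show ?case
      by (simp add: algebra_simps)
  qed (use assms in simp)
  then show ?thesis
    by (auto simp: wavefront_def zero_trace_def central_trace_def)
qed

lemma zero_trace_zero: "zero_trace (\<lambda>i. False)"
proof -
  have "(rule30 ^^ t) (\<lambda>i. False) = (\<lambda>i. False)" for t
    by (induction t) (simp_all add: rule30_def)
  then show ?thesis
    by (simp add: zero_trace_def central_trace_def)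
qed

section \<open>The zero-trace left half\<close>

definition zero_trace_left :: "(nat \<Rightarrow> bool) \<Rightarrow> nat \<Rightarrow> bool" where
  "zero_trace_left R j \<longleftrightarrow>
    (if odd j then \<exists>i\<in>{1..j}. R i else R j \<and> \<not> (\<exists>i\<in>{1..<j}. R i))"

text \<open>The closed form is column \<open>-j\<close> of the travelling pattern at time \<open>0\<close>: a prefix of the right half
  contains a \<open>1\<close> exactly if it reaches the first one.\<close>

lemma zero_trace_left_first_one:
  assumes "m \<ge> 1" and "R m" and "\<And>i. 1 \<le> i \<Longrightarrow> i < m \<Longrightarrow> \<not> R i" and "j \<ge> 1"
  shows "zero_trace_left R j = (if odd j then m \<le> j else j = m)"
proof -
  have prefix: "(\<exists>i\<in>{1..k}. R i) \<longleftrightarrow> m \<le> k" for k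
    using assms(1-3) by (meson atLeastAtMost_iff le_trans not_le)
  have "{1..<j} = {1..j - 1}"
    using \<open>j \<ge> 1\<close> by auto
  then show ?thesis
    using assms prefix[of j] prefix[of "j - 1"]
    by (auto simp: zero_trace_left_def not_le le_less_linear)
qed

lemma zero_trace_left_zero:
  assumes "\<forall>j\<ge>1. \<not> R j" and "j \<ge> 1"
  shows "\<not> zero_trace_left R j"
  using assms by (auto simp: zero_trace_left_def)

lemma first_one:
  fixes R :: "nat \<Rightarrow> bool"
  assumes "\<exists>j\<ge>1. R j"
  defines "m \<equiv> LEAST j. j \<ge> 1 \<and> R j"
  shows "m \<ge> 1" and "R m" and "\<And>i. 1 \<le> i \<Longrightarrow> i < m \<Longrightarrow> \<not> R i"
proof -
  from assms(1) have "m \<ge> 1 \<and> R m"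
    unfolding m_def by (rule LeastI_ex)
  then show "m \<ge> 1" and "R m" by blast+
  show "\<not> R i" if "1 \<le> i" "i < m" for i
    using not_less_Least that unfolding m_def by blast
qed

lemma zero_trace_config_zero_trace_left:
  assumes "\<not> R 0"
  shows "zero_trace (config (zero_trace_left R) R)"
proof (cases "\<exists>j\<ge>1. R j")
  case True
  define m where "m = (LEAST j. j \<ge> 1 \<and> R j)"
  note m = first_one[OF True, folded m_def]
  have "config (zero_trace_left R) R (- j) = (if odd j then int m \<le> j else j = int m)"
    if "j \<ge> 1" for j
    using zero_trace_left_first_one[of m R "nat j"] m that
    by (auto simp: config_def even_nat_iff nat_le_iff le_nat_iff)
  moreover have "\<not> config (zero_trace_left R) R i" if "0 < i" "i < int m" for i
    using m(3)[of "nat i"] that by (auto simp: config_def)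
  \<comment> \<open>Since \<open>m \<ge> 1\<close>, the cell at \<open>max 1 m\<close> is the first \<open>1\<close> itself.\<close>
  ultimately have "wavefront (int m) (config (zero_trace_left R) R)"
    using assms m(1,2) by (auto simp: wavefront_def config_def max_def)
  then show ?thesis
    by (rule wavefront_zero_trace)
next
  case False
  then have "\<not> R n" for n
    using assms by (cases n) auto
  then have "config (zero_trace_left R) R = (\<lambda>i. False)"
    using zero_trace_left_zero[of R] by (auto simp: config_def fun_eq_iff)
  then show ?thesis
    by (simp add: zero_trace_zero)
qed

text \<open>Existence of one left half with zero trace upgrades uniqueness to a characterization.\<close>

lemma zero_trace_config_iff:
  assumes "\<not> R 0"
  shows "zero_trace (config L R) \<longleftrightarrow> (\<forall>j\<ge>1. L j = zero_trace_left R j)"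
  using left_half_unique zero_trace_config_zero_trace_left[of R, OF assms]
    config_cong[of L "zero_trace_left R" R]
  by metis

section \<open>Closed forms\<close>

lemma zero_trace_left_cases:
  assumes "\<not> R 0"
  shows "(\<forall>j\<ge>1. L j = zero_trace_left R j) \<longleftrightarrow>
      ((\<exists>j\<ge>1. R j) \<longrightarrow>
        (let m = (LEAST j. j \<ge> 1 \<and> R j) in
          (\<forall>j. 1 \<le> j \<and> j < m \<longrightarrow> L j = False) \<and> L m = True \<and>
          (\<forall>j>m. of_bool (L j) = j mod 2))) \<and>
      ((\<forall>j\<ge>1. R j = False) \<longrightarrow> config L R = (\<lambda>i. False))"
proof (cases "\<exists>j\<ge>1. R j")
  case True
  define m where "m = (LEAST j. j \<ge> 1 \<and> R j)"
  note m = first_one[OF True, folded m_def]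
  have "(\<forall>j\<ge>1. L j = zero_trace_left R j) \<longleftrightarrow>
      (\<forall>j\<ge>1. L j = (if odd j then m \<le> j else j = m))"
    using zero_trace_left_first_one[of m R] m by auto
  also have "\<dots> \<longleftrightarrow> (\<forall>j. 1 \<le> j \<and> j < m \<longrightarrow> \<not> L j) \<and> L m \<and> (\<forall>j>m. L j = odd j)"
    (is "?A \<longleftrightarrow> ?B")
  proof
    assume ?A
    then show ?B using m(1) by auto
  next
    assume B: ?B
    show ?A
    proof (intro allI impI)
      fix j :: nat
      assume "j \<ge> 1"
      then show "L j = (if odd j then m \<le> j else j = m)"
        using B by (cases j m rule: linorder_cases) auto
    qed
  qed
  also have "(\<forall>j>m. L j = odd j) \<longleftrightarrow> (\<forall>j>m. of_bool (L j) = j mod 2)"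
    by (auto simp: mod_2_eq_odd)
  finally show ?thesis
    using True by (auto simp: Let_def m_def)
next
  case False
  have "config L R = (\<lambda>i. False) \<longleftrightarrow> (\<forall>j\<ge>1. \<not> L j)"
  proof
    assume zero: "config L R = (\<lambda>i. False)"
    show "\<forall>j\<ge>1. \<not> L j"
    proof (intro allI impI)
      fix j :: nat
      assume "j \<ge> 1"
      then show "\<not> L j"
        using fun_cong[OF zero, of "- int j"] by (simp add: config_def)
    qed
  next
    assume "\<forall>j\<ge>1. \<not> L j"
    moreover have "\<not> R n" for n
      using False assms by (cases n) auto
    ultimately show "config L R = (\<lambda>i. False)"
      by (auto simp: config_def fun_eq_iff)
  qed
  then show ?thesis
    using False zero_trace_left_zero[of R] by auto
qed

lemma zero_trace_left_parity:
  "(\<forall>j\<ge>1. L j = zero_trace_left R j) \<longleftrightarrow>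
      (\<forall>k. L (2 * k + 1) = (\<exists>j\<in>{1..2 * k + 1}. R j)) \<and>
      (\<forall>k\<ge>1. L (2 * k) = (R (2 * k) \<and> \<not> (\<exists>j\<in>{1..2 * k - 1}. R j)))"
proof -
  have odd: "zero_trace_left R (2 * k + 1) = (\<exists>j\<in>{1..2 * k + 1}. R j)" for k
    by (simp add: zero_trace_left_def)
  have even: "zero_trace_left R (2 * k) = (R (2 * k) \<and> \<not> (\<exists>j\<in>{1..2 * k - 1}. R j))"
    if "k \<ge> 1" for k
  proof -
    have "{1..<2 * k} = {1..2 * k - 1}"
      using that by auto
    then show ?thesis
      by (simp add: zero_trace_left_def)
  qed
  have "(\<forall>j\<ge>1. P j) \<longleftrightarrow> (\<forall>k. P (2 * k + 1)) \<and> (\<forall>k\<ge>1. P (2 * k))" for P :: "nat \<Rightarrow> bool"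
  proof
    assume r: "(\<forall>k. P (2 * k + 1)) \<and> (\<forall>k\<ge>1. P (2 * k))"
    show "\<forall>j\<ge>1. P j"
    proof (intro allI impI)
      fix j :: nat
      assume "j \<ge> 1"
      then show "P j"
        using r by (cases "even j") (auto elim!: evenE oddE)
    qed
  qed auto
  from this[of "\<lambda>j. L j = zero_trace_left R j"] show ?thesis
    using odd even by simp
qed

theorem theorem2:
  fixes R :: "nat \<Rightarrow> bool"
  assumes "R 0 = False"
  shows "(\<exists>!L. L \<in> {1..} \<rightarrow>\<^sub>E UNIV \<and> zero_trace (config L R)) \<and>
    (\<forall>L. zero_trace (config L R) \<longleftrightarrow>
      ((\<exists>j\<ge>1. R j) \<longrightarrow>
        (let m = (LEAST j. j \<ge> 1 \<and> R j) in
          (\<forall>j. 1 \<le> j \<and> j < m \<longrightarrow> L j = False) \<and> L m = True \<and>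
          (\<forall>j>m. of_bool (L j) = j mod 2))) \<and>
      ((\<forall>j\<ge>1. R j = False) \<longrightarrow> config L R = (\<lambda>i. False))) \<and>
    (\<forall>L. zero_trace (config L R) \<longleftrightarrow>
      (\<forall>k. L (2 * k + 1) = (\<exists>j\<in>{1..2 * k + 1}. R j)) \<and>
      (\<forall>k\<ge>1. L (2 * k) = (R (2 * k) \<and> \<not> (\<exists>j\<in>{1..2 * k - 1}. R j))))"
proof -
  have R0: "\<not> R 0"
    using assms by simp
  note iff = zero_trace_config_iff[of R, OF R0]
  have "\<exists>!L. L \<in> {1..} \<rightarrow>\<^sub>E UNIV \<and> (\<forall>j\<ge>1. L j = zero_trace_left R j)"
  proof (rule ex1I[of _ "restrict (zero_trace_left R) {1..}"])
    fix L
    assume "L \<in> {1..} \<rightarrow>\<^sub>E UNIV \<and> (\<forall>j\<ge>1. L j = zero_trace_left R j)"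
    then have L: "L \<in> extensional {1..}" "\<And>j. j \<ge> 1 \<Longrightarrow> L j = zero_trace_left R j"
      by (simp_all add: PiE_def)
    show "L = restrict (zero_trace_left R) {1..}"
      by (rule extensionalityI[OF L(1) restrict_extensional]) (simp add: L(2))
  qed simp
  then show ?thesis
    unfolding iff using zero_trace_left_cases[of R, OF R0] zero_trace_left_parity[of _ R] by blast
qed

end
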